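(* Let $A \in \{0,\star\}^{d\times d}$ and $B\in\{0,\star\}^{d\times m}$ be such that $(A,B)$ is structurally controllable, and let each nonzero entry $B_{ij}$ carry a cost $w_{ij}\ge 0$. Suppose that the digraph $G(A)$ is a directed tree rooted at some vertex $v_i$. Then the matrix $B^{*}$ produced by the matching algorithm (described in the context) solves the problem $\min_{B'\in\mathcal{K}}\|B'\|_w$; that is, $B^{*}\in\mathcal{K}$ and $\|B^{*}\|_w\le\|B'\|_w$ for all $B'\in\mathcal{K}$.
   Context: A matrix with entries in $\{0,\star\}$ is a sparsity matrix: each entry is either a fixed zero or an independent free parameter $\star$. A numerical realization is obtained by assigning real values to the $\star$ entries (zeros stay zero). The pair $(A,B)$ with $A\in\{0,\star\}^{d\times d}$, $B\in\{0,\star\}^{d\times m}$ is structurally controllable if there is at least one numerical realization $(A',B')$ of $(A,B)$ such that the linear system $\dot x = A'x+B'u$ is controllable. $Z(B)=\{(i,j) : B_{ij}=0\}$, and $\mathcal{K}$ is the set of all $B'\in\{0,\star\}^{d\times m}$ with $Z(B)\subset Z(B')$ and $(A,B')$ structurally controllable. For $B'\in\mathcal{K}$, $\|B'\|_w=\sum_{(i,j): B'_{ij}\ne0} w_{ij}$. $G(A)$ is the digraph with vertex set $\{v_1,\dots,v_d\}$ and a directed edge $(v_j,v_i)$ whenever $A_{ij}\neq 0$. A digraph is acyclic if it contains no directed cycle. A directed tree rooted at $x$ is an acyclic digraph in which $x$ has a directed path to every vertex. $\Gamma(A,B)$ is the undirected bipartite graph with parts $V_A^1\sqcup V_B$ and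 $V_A^2$, where $V_A^1=\{v_1^1,\dots,v_d^1\}$, $V_A^2=\{v_1^2,\dots,v_d^2\}$, $V_B=\{u_1,\dots,u_m\}$, and edge set $\mathcal{E}_A\sqcup\mathcal{E}_B$, where $\mathcal{E}_A=\{(v_j^1,v_i^2): A_{ij}\ne0\}$ and $\mathcal{E}_B=\{(u_j,v_i^2): B_{ij}\neq0\}$. Given a non-negative edge cost function, a minimum cost maximum matching (MCMM) is a matching of maximum cardinality whose total cost is minimal among all maximum cardinality matchings. Matching algorithm. Construct $\Gamma(A,B)$, with cost $c(e)=0$ for $e\in\mathcal{E}_A$ and $c(e)=w_{kj}$ for $e=(u_j,v_k^2)\in\mathcal{E}_B$. Find an MCMM $M^{*}$ in $\Gamma(A,B)$ with cost $c$. Output $B^{*}\in\{0,\star\}^{d\times m}$ with $B^{*}_{\ell k}=\star$ if $(u_k,v_\ell^2)\in M^{*}\cap\mathcal{E}_B$ and $B^{*}_{\ell k}=0$ otherwise. *)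

theory Defs
  imports "HOL-Analysis.Analysis"
begin

datatype entry = Zero | Star

type_synonym ('n, 'd) sparsity = "entry ^ 'n ^ 'd"

(* A free entry may also be assigned the value 0. *)
definition realization :: "('n::finite, 'd::finite) sparsity \<Rightarrow> real ^ 'n ^ 'd \<Rightarrow> bool" where
  "realization S R \<longleftrightarrow> (\<forall>i j. S $ i $ j = Zero \<longrightarrow> R $ i $ j = 0)"

(* Every initial state can be steered to every final state in some finite time; the inputs
   are continuous and the trajectories are classical solutions of x' = A x + B u. *)
definition controllable :: "real ^ 'd ^ 'd \<Rightarrow> real ^ 'm ^ 'd \<Rightarrow> bool" where
  "controllable A B \<longleftrightarrow>
     (\<forall>x0 x1 :: real ^ 'd. \<exists>T > 0. \<exists>(u :: real \<Rightarrow> real ^ 'm) (x :: real \<Rightarrow> real ^ 'd).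
        continuous_on {0..T} u \<and> x 0 = x0 \<and> x T = x1 \<and>
        (\<forall>t \<in> {0..T}. (x has_vector_derivative (A *v x t + B *v u t)) (at t within {0..T})))"

definition structurally_controllable ::
    "('d::finite, 'd) sparsity \<Rightarrow> ('m::finite, 'd) sparsity \<Rightarrow> bool" where
  "structurally_controllable A B \<longleftrightarrow>
     (\<exists>A' B'. realization A A' \<and> realization B B' \<and> controllable A' B')"

definition zero_pattern :: "('m::finite, 'd::finite) sparsity \<Rightarrow> ('d \<times> 'm) set" where
  "zero_pattern B = {(i, j). B $ i $ j = Zero}"

definition feasible ::
    "('d::finite, 'd) sparsity \<Rightarrow> ('m::finite, 'd) sparsity \<Rightarrow> ('m, 'd) sparsity set" where
  "feasible A B =
     {B'. zero_pattern B \<subseteq> zero_pattern B' \<and> structurally_controllable A B'}"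

definition weight :: "('d \<Rightarrow> 'm \<Rightarrow> real) \<Rightarrow> ('m::finite, 'd::finite) sparsity \<Rightarrow> real" where
  "weight w B = (\<Sum>(i, j) \<in> {(i, j). B $ i $ j \<noteq> Zero}. w i j)"

(* Edges of G(A); the vertex set is UNIV. A nonzero diagonal entry gives a loop, which is a
   directed cycle of length 1. *)
definition digraph_of :: "('d::finite, 'd) sparsity \<Rightarrow> 'd rel" where
  "digraph_of A = {(j, i). A $ i $ j \<noteq> Zero}"

(* Follows the convention that a directed tree is an acyclic digraph with a root reaching
   every vertex; directed paths to a vertex need not be unique. *)
definition directed_tree_rooted_at :: "'v rel \<Rightarrow> 'v \<Rightarrow> bool" where
  "directed_tree_rooted_at E r \<longleftrightarrow> acyclic E \<and> (\<forall>v. (r, v) \<in> E\<^sup>*)"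

(* V1 and V2 are the two copies of the state vertices, U the input vertices. *)
datatype ('d, 'm) vertex = V1 'd | U 'm | V2 'd

(* An undirected edge of the bipartite graph is written as the pair (x, y) with x in the part
   of V1 and U vertices and y in the part of V2 vertices. *)
type_synonym ('d, 'm) edge = "('d, 'm) vertex \<times> ('d, 'm) vertex"

definition edges_A :: "('d::finite, 'd) sparsity \<Rightarrow> ('d, 'm) edge set" where
  "edges_A A = {(V1 j, V2 i) | i j. A $ i $ j \<noteq> Zero}"

definition edges_B :: "('m::finite, 'd::finite) sparsity \<Rightarrow> ('d, 'm) edge set" where
  "edges_B B = {(U j, V2 i) | i j. B $ i $ j \<noteq> Zero}"

definition bipartite_edges ::
    "('d::finite, 'd) sparsity \<Rightarrow> ('m::finite, 'd) sparsity \<Rightarrow> ('d, 'm) edge set" where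
  "bipartite_edges A B = edges_A A \<union> edges_B B"

definition matching :: "('v \<times> 'v) set \<Rightarrow> ('v \<times> 'v) set \<Rightarrow> bool" where
  "matching E M \<longleftrightarrow> M \<subseteq> E \<and>
     (\<forall>e \<in> M. \<forall>f \<in> M. e \<noteq> f \<longrightarrow> {fst e, snd e} \<inter> {fst f, snd f} = {})"

definition maximum_matching :: "('v \<times> 'v) set \<Rightarrow> ('v \<times> 'v) set \<Rightarrow> bool" where
  "maximum_matching E M \<longleftrightarrow> matching E M \<and> (\<forall>N. matching E N \<longrightarrow> card N \<le> card M)"

definition min_cost_maximum_matching ::
    "('v \<times> 'v) set \<Rightarrow> ('v \<times> 'v \<Rightarrow> real) \<Rightarrow> ('v \<times> 'v) set \<Rightarrow> bool" where
  "min_cost_maximum_matching E c M \<longleftrightarrow> maximum_matching E M \<and>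
     (\<forall>N. maximum_matching E N \<longrightarrow> sum c M \<le> sum c N)"

fun edge_cost :: "('d \<Rightarrow> 'm \<Rightarrow> real) \<Rightarrow> ('d, 'm) edge \<Rightarrow> real" where
  "edge_cost w (U j, V2 k) = w k j"
| "edge_cost w _ = 0"

definition matching_pattern ::
    "('m::finite, 'd::finite) sparsity \<Rightarrow> ('d, 'm) edge set \<Rightarrow> ('m, 'd) sparsity" where
  "matching_pattern B M =
     (\<chi> l k. if (U k, V2 l) \<in> M \<inter> edges_B B then Star else Zero)"

(* The algorithm may return any minimum cost maximum matching, so its outcome is a relation;
   by the lemma below it always has at least one output. *)
definition matching_algorithm_output ::
    "('d::finite, 'd) sparsity \<Rightarrow> ('m::finite, 'd) sparsity \<Rightarrow> ('d \<Rightarrow> 'm \<Rightarrow> real)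
       \<Rightarrow> ('m, 'd) sparsity \<Rightarrow> bool" where
  "matching_algorithm_output A B w Bstar \<longleftrightarrow>
     (\<exists>M. min_cost_maximum_matching (bipartite_edges A B) (edge_cost w) M \<and>
          Bstar = matching_pattern B M)"

lemma finite_bipartite_edges: "finite (bipartite_edges A B)"
proof -
  have "bipartite_edges A B \<subseteq> (\<lambda>(j, i). (V1 j, V2 i)) ` UNIV \<union> (\<lambda>(j, i). (U j, V2 i)) ` UNIV"
    by (auto simp: bipartite_edges_def edges_A_def edges_B_def)
  then show ?thesis by (rule finite_subset) auto
qed

lemma min_cost_maximum_matching_exists:
  assumes "finite E"
  shows "\<exists>M. min_cost_maximum_matching E c M"
proof -
  have sub: "{M. matching E M} \<subseteq> Pow E" by (auto simp: matching_def)
  then have fin: "finite {M. matching E M}" using assms by (meson finite_Pow_iff finite_subset)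
  have "{} \<in> {M. matching E M}" by (simp add: matching_def)
  then obtain M where M: "maximum_matching E M"
    using finite_imageI[OF fin, of card] Max_in[of "card ` {M. matching E M}"]
      Max_ge[of "card ` {M. matching E M}"]
    unfolding maximum_matching_def by (smt (verit) empty_iff image_iff mem_Collect_eq)
  have fin': "finite {M. maximum_matching E M}"
    by (rule finite_subset[OF _ fin]) (auto simp: maximum_matching_def)
  have "{M. maximum_matching E M} \<noteq> {}" using M by blast
  from ex_min_if_finite[OF finite_imageI[OF fin', of "sum c"]] this
  obtain N where "maximum_matching E N" "\<forall>N'. maximum_matching E N' \<longrightarrow> \<not> sum c N' < sum c N"
    by blast
  then show ?thesis unfolding min_cost_maximum_matching_def by (meson linorder_not_less)
qed

lemma matching_algorithm_output_exists: "\<exists>Bstar. matching_algorithm_output A B w Bstar"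
  unfolding matching_algorithm_output_def
  using min_cost_maximum_matching_exists[OF finite_bipartite_edges] by blast

end

theory Submission
  imports Defs "HOL-Computational_Algebra.Polynomial"
begin

text \<open>Controllability forces \<open>[A' B']\<close> to have full row rank, so for every feasible \<open>B'\<close> some
  matching covers all state vertices \<open>V2 v\<close>, and it costs at most \<open>\<parallel>B'\<parallel>\<^sub>w\<close>. Conversely, since \<open>G(A)\<close> is
  acyclic, such a matching splits the states into disjoint chains, each starting at its own input;
  setting the matched entries to 1 and all others to 0 gives decoupled integrator chains, which are
  controllable.\<close>

section \<open>Polynomials with prescribed derivatives at two points\<close>

text \<open>Each differentiation removes one factor \<open>[:-c, 1:]\<close> and multiplies the
  value of the cofactor at \<open>c\<close> by the old exponent; these multipliers accumulate to
  \<open>fact n\<close>.\<close>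

lemma poly_higher_pderiv_root_power:
  fixes c :: "'a :: {idom, semiring_char_0}"
  assumes "j \<le> n"
  shows "poly ((pderiv ^^ j) ([:-c, 1:] ^ n * q)) c = (if j = n then fact n * poly q c else 0)"
  using assms
proof (induction n arbitrary: j q)
  case 0
  then show ?case by simp
next
  case (Suc n)
  show ?case
  proof (cases j)
    case 0
    then show ?thesis by simp
  next
    case (Suc i)
    have "pderiv ([:-c, 1:] ^ Suc n * q) =
        [:-c, 1:] ^ n * (smult (of_nat (Suc n)) q + [:-c, 1:] * pderiv q)"
      unfolding pderiv_mult pderiv_power_Suc by (simp add: pderiv_pCons algebra_simps)
    then have "(pderiv ^^ j) ([:-c, 1:] ^ Suc n * q) =
        (pderiv ^^ i) ([:-c, 1:] ^ n * (smult (of_nat (Suc n)) q + [:-c, 1:] * pderiv q))"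
      by (simp only: Suc funpow_Suc_right o_apply)
    then show ?thesis
      using Suc.IH[of i "smult (of_nat (Suc n)) q + [:-c, 1:] * pderiv q"] Suc.prems Suc
      by (auto simp: algebra_simps)
  qed
qed

lemma two_point_hermite_interpolation:
  fixes a b :: "nat \<Rightarrow> real"
  shows "\<exists>p. \<forall>j<n. poly ((pderiv ^^ j) p) 0 = a j \<and> poly ((pderiv ^^ j) p) 1 = b j"
proof (induction n)
  case 0
  then show ?case by simp
next
  case (Suc n)
  then obtain p where p: "\<And>j. j < n \<Longrightarrow> poly ((pderiv ^^ j) p) 0 = a j"
    "\<And>j. j < n \<Longrightarrow> poly ((pderiv ^^ j) p) 1 = b j"
    by blast
  \<comment> \<open>The correction \<open>r\<close> vanishes to order \<open>n\<close> at 0 and at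
    1, so earlier conditions survive. Its \<open>n\<close>-th derivative is
    \<open>fact n * (-1) ^ n * \<alpha>\<close> at 0 and
    \<open>fact n * (\<alpha> + \<beta>)\<close> at 1; solving for the missing values gives
    \<open>\<alpha>\<close> and \<open>\<beta>\<close>.\<close>
  define \<alpha> where "\<alpha> = (-1) ^ n * (a n - poly ((pderiv ^^ n) p) 0) / fact n"
  define \<beta> where "\<beta> = (b n - poly ((pderiv ^^ n) p) 1) / fact n - \<alpha>"
  define r where "r = [:-0, 1:] ^ n * ([:-1, 1:] ^ n * [:\<alpha>, \<beta>:])"
  have r': "r = [:-1, 1:] ^ n * ([:-0, 1:] ^ n * [:\<alpha>, \<beta>:])"
    by (simp only: r_def mult.left_commute)
  have r0: "poly ((pderiv ^^ j) r) 0 = (if j = n then a n - poly ((pderiv ^^ n) p) 0 else 0)"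
    if "j \<le> n" for j
    unfolding r_def poly_higher_pderiv_root_power[OF that]
    by (simp add: \<alpha>_def flip: power_mult_distrib)
  have r1: "poly ((pderiv ^^ j) r) 1 = (if j = n then b n - poly ((pderiv ^^ n) p) 1 else 0)"
    if "j \<le> n" for j
    unfolding r' poly_higher_pderiv_root_power[OF that] by (simp add: \<beta>_def)
  have "\<forall>j<Suc n. poly ((pderiv ^^ j) (p + r)) 0 = a j \<and> poly ((pderiv ^^ j) (p + r)) 1 = b j"
    using p r0 r1 by (auto simp: higher_pderiv_add less_Suc_eq)
  then show ?case by blast
qed

section \<open>Controllability of integrator chains\<close>

text \<open>The map \<open>p\<close> gives each state its unique predecessor, another state or an input,
  so the states form chains driven by distinct inputs. The trajectory of the last state of a chain
  is free, and the others are its successive derivatives.\<close>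

lemma controllable_chains:
  fixes p :: "'d::finite \<Rightarrow> 'd + 'm::finite"
  assumes "inj p" and acyc: "acyclic {(w, v). p v = Inl w}"
  shows "controllable (\<chi> v w. if p v = Inl w then 1 else 0) (\<chi> v k. if p v = Inr k then 1 else 0)"
    (is "controllable ?A ?B")
  unfolding controllable_def
proof (intro allI)
  fix x0 x1 :: "real ^ 'd"
  define E where "E = {(w, v). p v = Inl w}"
  \<comment> \<open>\<open>\<rho> v\<close> is the position of \<open>v\<close> in its chain,
    counted from 1 at the state next to the input.\<close>
  define \<rho> where "\<rho> v = card {u. (u, v) \<in> E\<^sup>*}" for v
  have \<rho>_less: "\<rho> w < \<rho> s" if "p s = Inl w" for s w
  proof -
    have e: "(w, s) \<in> E" using that by (simp add: E_def)
    then have "(s, w) \<notin> E\<^sup>*"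
      using acyc unfolding E_def[symmetric] acyclic_def by (meson rtrancl_into_trancl2)
    then have "{u. (u, w) \<in> E\<^sup>*} \<subset> {u. (u, s) \<in> E\<^sup>*}"
      using e by (auto intro: rtrancl_into_rtrancl)
    then show ?thesis unfolding \<rho>_def by (intro psubset_card_mono) auto
  qed
  have \<rho>_pos: "0 < \<rho> v" for v
    unfolding \<rho>_def by (auto simp: card_gt_0_iff)
  \<comment> \<open>The coordinate of \<open>x\<close> at the \<open>j\<close>-fold predecessor of
    \<open>v\<close>. The default 0 past the input is never reached for
    \<open>j < \<rho> v\<close>.\<close>
  define anc where "anc x v j =
    rec_nat (\<lambda>v. x $ v) (\<lambda>_ g v. case p v of Inl w \<Rightarrow> g w | Inr _ \<Rightarrow> 0) j v" for x :: "real ^ 'd" and v j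
  have anc_0: "anc x v 0 = x $ v" for x v by (simp add: anc_def)
  have anc_Suc: "anc x s (Suc j) = anc x w j" if "p s = Inl w" for x s w j
    using that by (simp add: anc_def)
  \<comment> \<open>\<open>y\<close> is an admissible trajectory for \<open>v\<close>: since
    differentiating moves one state towards the input, the \<open>j\<close>-th derivative must have
    the boundary values of the \<open>j\<close>-th predecessor.\<close>
  define P where "P Y v y \<longleftrightarrow>
    (\<forall>j<\<rho> v. poly ((pderiv ^^ j) y) 0 = anc x0 v j \<and> poly ((pderiv ^^ j) y) 1 = anc x1 v j) \<and>
    (\<forall>s. p s = Inl v \<longrightarrow> y = pderiv (Y s))" for Y :: "'d \<Rightarrow> real poly" and v y
  \<comment> \<open>The recursion starts at the last state of each chain and runs towards the input,
    so a successor precedes its predecessor in this order.\<close>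
  have "wf {(s, w). p s = Inl w}"
  proof (rule finite_acyclic_wf)
    have "{(s, w). p s = Inl w} = E\<inverse>" by (auto simp: E_def)
    then show "acyclic {(s, w). p s = Inl w}"
      using acyc by (simp add: E_def[symmetric])
  qed auto
  then have "\<exists>Y. \<forall>v. P Y v (Y v)"
  proof (rule dependent_wf_choice)
    fix Y Z :: "'d \<Rightarrow> real poly" and v y
    assume "\<And>z. (z, v) \<in> {(s, w). p s = Inl w} \<Longrightarrow> Y z = Z z"
    then show "P Y v y = P Z v y" by (simp add: P_def)
  next
    fix v :: 'd and Y :: "'d \<Rightarrow> real poly"
    assume IH: "\<And>s. (s, v) \<in> {(s, w). p s = Inl w} \<Longrightarrow> P Y s (Y s)"
    show "\<exists>y. P Y v y"
    proof (cases "\<exists>s. p s = Inl v")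
      case True
      then obtain s where s: "p s = Inl v" by blast
      then have Ps: "P Y s (Y s)" using IH by blast
      have "poly ((pderiv ^^ j) (pderiv (Y s))) 0 = anc x0 v j \<and>
          poly ((pderiv ^^ j) (pderiv (Y s))) 1 = anc x1 v j" if "j < \<rho> v" for j
      proof -
        have "Suc j < \<rho> s" using that \<rho>_less[OF s] by linarith
        then show ?thesis
          using Ps unfolding P_def by (metis anc_Suc[OF s] funpow_Suc_right o_apply)
      qed
      \<comment> \<open>Injectivity leaves \<open>v\<close> only one successor, so only one
        derivative is imposed on it.\<close>
      moreover have "s' = s" if "p s' = Inl v" for s'
        using that s \<open>inj p\<close> by (metis injD)
      ultimately have "P Y v (pderiv (Y s))" by (auto simp: P_def)
      then show ?thesis by blast
    next
      case False
      then show ?thesis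
        unfolding P_def using two_point_hermite_interpolation[of "\<rho> v" "anc x0 v" "anc x1 v"] by auto
    qed
  qed
  then obtain Y where Y: "\<And>v. P Y v (Y v)" by blast
  have Y_deriv: "pderiv (Y s) = Y w" if "p s = Inl w" for s w
    using Y[of w] that by (auto simp: P_def)
  have Y0: "poly (Y v) 0 = x0 $ v" and Y1: "poly (Y v) 1 = x1 $ v" for v
    using Y[of v] \<rho>_pos[of v] by (auto simp: P_def anc_0 dest: spec[of _ 0])
  define x where "x t = (\<chi> v. poly (Y v) t)" for t
  \<comment> \<open>An input supplies the derivative of the first state of its chain; inputs without
    a chain stay 0.\<close>
  define u where "u t = (\<chi> k. if \<exists>v. p v = Inr k then poly (pderiv (Y (inv p (Inr k)))) t else 0)"
    for t :: real
  have rhs: "(?A *v x t + ?B *v u t) $ v = poly (pderiv (Y v)) t" for v t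
  proof (cases "p v")
    case (Inl w)
    then show ?thesis
      by (simp add: matrix_vector_mult_def x_def Y_deriv if_distrib[of "\<lambda>c. c * _"] cong: if_cong)
  next
    case (Inr k)
    then have "inv p (Inr k) = v" "\<exists>v. p v = Inr k"
      using \<open>inj p\<close> by (auto intro: inv_f_eq)
    then show ?thesis using Inr
      by (simp add: matrix_vector_mult_def u_def if_distrib[of "\<lambda>c. c * _"] cong: if_cong)
  qed
  have "continuous_on {0..1} u"
    unfolding u_def
  proof (rule continuous_on_vec_lambda)
    show "continuous_on {0..1}
        (\<lambda>t. if \<exists>v. p v = Inr k then poly (pderiv (Y (inv p (Inr k)))) t else 0)" for k
      by (cases "\<exists>v. p v = Inr k") (simp_all add: continuous_on_poly)
  qed
  moreover have "x 0 = x0" "x 1 = x1"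
    by (simp_all add: x_def Y0 Y1 vec_eq_iff)
  moreover have "(x has_vector_derivative (?A *v x t + ?B *v u t)) (at t within {0..1})" for t
    unfolding has_vector_derivative_def
  proof (subst has_derivative_componentwise_within, intro ballI)
    fix e :: "real ^ 'd"
    assume "e \<in> Basis"
    then obtain v where e: "e = axis v 1" by (auto simp: Basis_vec_def)
    have "((\<lambda>t. poly (Y v) t) has_real_derivative poly (pderiv (Y v)) t) (at t within {0..1})"
      by (rule has_field_derivative_at_within[OF poly_DERIV])
    then show "((\<lambda>t. x t \<bullet> e) has_derivative (\<lambda>h. (h *\<^sub>R (?A *v x t + ?B *v u t)) \<bullet> e))
        (at t within {0..1})"
      by (simp only: e inner_axis inner_real_def mult_1_right vector_scaleR_component rhs)
        (simp add: x_def has_field_derivative_def mult_commute_abs)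
  qed
  ultimately show "\<exists>T>0. \<exists>u x. continuous_on {0..T} u \<and> x 0 = x0 \<and> x T = x1 \<and>
      (\<forall>t\<in>{0..T}. (x has_vector_derivative (?A *v x t + ?B *v u t)) (at t within {0..T}))"
    by (intro exI[of _ "1::real"] conjI exI[of _ u] exI[of _ x]) auto
qed

section \<open>Full row rank and transversals\<close>

text \<open>A vector \<open>q\<close> orthogonal to the columns would make \<open>q \<bullet> x\<close> a conserved quantity.\<close>

lemma controllable_imp_span_columns:
  assumes "controllable A B"
  shows "span (columns A \<union> columns B) = (UNIV :: (real ^ 'd) set)"
proof (rule ccontr)
  assume "span (columns A \<union> columns B) \<noteq> UNIV"
  then obtain q where q: "q \<noteq> 0" "\<And>y. y \<in> span (columns A \<union> columns B) \<Longrightarrow> q \<bullet> y = 0"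
    using span_not_UNIV_orthogonal by blast
  have "A *v y + B *v z \<in> span (columns A \<union> columns B)" for y z
    by (intro span_add subsetD[OF span_mono matrix_vector_mult_in_columnspace]) auto
  then have orth: "q \<bullet> (A *v y + B *v z) = 0" for y z by (rule q(2))
  \<comment> \<open>Steering from 0 to \<open>q\<close> itself turns conservation into
    \<open>q \<bullet> q = 0\<close>.\<close>
  obtain T u x where "T > 0" "x 0 = 0" "x T = q"
    and x: "\<And>t. t \<in> {0..T} \<Longrightarrow>
      (x has_vector_derivative (A *v x t + B *v u t)) (at t within {0..T})"
    using assms unfolding controllable_def by metis
  have "q \<bullet> x T = q \<bullet> x 0"
  proof (rule has_derivative_zero_unique[where s = "{0..T}" and f = "\<lambda>t. q \<bullet> x t"])
    fix t assume "t \<in> {0..T}"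
    from has_derivative_inner_right[OF x[OF this, unfolded has_vector_derivative_def], of q]
    show "((\<lambda>t. q \<bullet> x t) has_derivative (\<lambda>_. 0)) (at t within {0..T})"
      by (simp add: orth)
  qed (use \<open>T > 0\<close> in auto)
  then show False using \<open>x 0 = 0\<close> \<open>x T = q\<close> \<open>q \<noteq> 0\<close> by simp
qed

text \<open>The transversal is a nonvanishing term in the determinant of a basis chosen among the
  vectors.\<close>

lemma span_transversal:
  fixes F :: "'i \<Rightarrow> real ^ 'd::finite"
  assumes "span (range F) = UNIV"
  shows "\<exists>g. inj g \<and> (\<forall>i. F (g i) $ i \<noteq> 0)"
proof -
  obtain D where D: "D \<subseteq> range F" "independent D" "range F \<subseteq> span D"
    using maximal_independent_subset by blast
  then have "span D = UNIV" using assms by (metis span_mono span_span top.extremum_uniqueI)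
  then have "card D = CARD('d)"
    using D(2) by (metis dim_eq_card_independent dim_span dim_UNIV DIM_cart DIM_real mult.right_neutral)
  moreover have "finite D" using D(2) by (rule independent_imp_finite)
  ultimately obtain h :: "'d \<Rightarrow> real ^ 'd" where h: "bij_betw h UNIV D"
    by (metis finite finite_same_card_bij)
  define M where "M = (\<chi> i j. h j $ i)"
  have "column j M = h j" for j by (simp add: column_def M_def vec_eq_iff)
  then have "columns M = D" using h by (auto simp: columns_def bij_betw_def)
  then have "det M \<noteq> 0"
    using \<open>span D = UNIV\<close> matrix_right_invertible_span_columns[of M]
    by (metis invertible_det_nz invertible_right_inverse span_vec_eq)
  then obtain \<sigma> where \<sigma>: "\<sigma> permutes UNIV" "(\<Prod>i\<in>UNIV. M $ i $ \<sigma> i) \<noteq> 0"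
    unfolding det_def by (metis (no_types, lifting) mem_Collect_eq mult_zero_right sum.neutral)
  \<comment> \<open>\<open>F\<close> may repeat vectors, so an index is chosen for each basis
    vector; distinct basis vectors get distinct indices.\<close>
  have "\<forall>j. \<exists>k. h j = F k" using h D(1) by (auto simp: bij_betw_def)
  then obtain c where c: "\<And>j. h j = F (c j)" by metis
  have "inj (c \<circ> \<sigma>)"
  proof (rule injI)
    fix i j assume "(c \<circ> \<sigma>) i = (c \<circ> \<sigma>) j"
    then have "h (\<sigma> i) = h (\<sigma> j)" by (simp add: c)
    then show "i = j"
      using h permutes_inj[OF \<sigma>(1)] by (metis bij_betw_imp_inj_on injD)
  qed
  moreover have "F ((c \<circ> \<sigma>) i) $ i \<noteq> 0" for i
    using \<sigma>(2) by (simp add: M_def c)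
  ultimately show ?thesis by blast
qed

text \<open>The columns of a controllable realization span the state space and so have a
  transversal; its nonzero entries can only sit at stars.\<close>

lemma structurally_controllable_transversal:
  fixes A :: "('d::finite, 'd) sparsity" and B :: "('m::finite, 'd) sparsity"
  assumes "structurally_controllable A B"
  obtains p :: "'d \<Rightarrow> 'd + 'm"
  where "inj p" "\<And>v w. p v = Inl w \<Longrightarrow> A $ v $ w \<noteq> Zero" "\<And>v k. p v = Inr k \<Longrightarrow> B $ v $ k \<noteq> Zero"
proof -
  obtain A' B' where real: "realization A A'" "realization B B'" and ctrl: "controllable A' B'"
    using assms unfolding structurally_controllable_def by blast
  define F where "F = case_sum (\<lambda>w. column w A') (\<lambda>k. column k B')"
  have "range F = columns A' \<union> columns B'"
    by (simp add: F_def columns_def UNIV_sum image_Un image_image full_SetCompr_eq)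
  then have "span (range F) = UNIV"
    using controllable_imp_span_columns[OF ctrl] by simp
  then obtain p where p: "inj p" "\<And>v. F (p v) $ v \<noteq> 0"
    using span_transversal by blast
  have "A $ v $ w \<noteq> Zero" if "p v = Inl w" for v w
    using p(2)[of v] real(1) that by (auto simp: F_def column_def realization_def)
  moreover have "B $ v $ k \<noteq> Zero" if "p v = Inr k" for v k
    using p(2)[of v] real(2) that by (auto simp: F_def column_def realization_def)
  ultimately show thesis using p(1) that by blast
qed

section \<open>Perfect matchings as injective predecessor maps\<close>

definition pred_edge :: "('d \<Rightarrow> 'd + 'm) \<Rightarrow> 'd \<Rightarrow> ('d, 'm) edge" where
  "pred_edge p v = (case_sum V1 U (p v), V2 v)"

lemma case_sum_V1_U_eq_iff [simp]:
  "case_sum V1 U s = V1 w \<longleftrightarrow> s = Inl w"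
  "case_sum V1 U s = U k \<longleftrightarrow> s = Inr k"
  "case_sum V1 U s = case_sum V1 U s' \<longleftrightarrow> s = s'"
  "case_sum V1 U s \<noteq> V2 v"
  "V2 v \<noteq> case_sum V1 U s"
  by (cases s; cases s'; auto)+

lemma pred_edge_mem_bipartite_edges:
  "pred_edge p v \<in> bipartite_edges A B \<longleftrightarrow>
     (case p v of Inl w \<Rightarrow> A $ v $ w \<noteq> Zero | Inr k \<Rightarrow> B $ v $ k \<noteq> Zero)"
  by (auto simp: pred_edge_def bipartite_edges_def edges_A_def edges_B_def split: sum.splits)

lemma matching_range_pred_edge:
  assumes "inj p" "\<And>v. pred_edge p v \<in> E"
  shows "matching E (range (pred_edge p))"
  using assms by (auto simp: matching_def pred_edge_def inj_eq)

lemma card_range_pred_edge: "card (range (pred_edge (p :: 'd::finite \<Rightarrow> 'd + 'm))) = CARD('d)"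
  by (rule card_image) (auto simp: inj_on_def pred_edge_def)

lemma inj_on_snd_matching: "matching E M \<Longrightarrow> inj_on snd M"
  unfolding matching_def inj_on_def by blast

lemma snd_matching_subset:
  "matching (bipartite_edges A B) M \<Longrightarrow> snd ` M \<subseteq> range V2"
  by (auto simp: matching_def bipartite_edges_def edges_A_def edges_B_def)

lemma card_range_V2: "card (range (V2 :: 'd::finite \<Rightarrow> ('d, 'm) vertex)) = CARD('d)"
  by (rule card_image) (auto simp: inj_on_def)

lemma card_matching_le:
  fixes A :: "('d::finite, 'd) sparsity"
  assumes "matching (bipartite_edges A B) M"
  shows "card M \<le> CARD('d)"
  using card_mono[OF _ snd_matching_subset[OF assms]] card_range_V2
    card_image[OF inj_on_snd_matching[OF assms]] by (metis finite finite_imageI)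

text \<open>By cardinality the matching covers every \<open>V2 v\<close>, and the partner of
  \<open>V2 v\<close> serves as \<open>p v\<close>. No two edges share a left end, hence
  \<open>p\<close> is injective.\<close>

lemma perfect_matching_eq_range_pred_edge:
  fixes A :: "('d::finite, 'd) sparsity" and B :: "('m::finite, 'd) sparsity"
  assumes M: "matching (bipartite_edges A B) M" and card: "card M = CARD('d)"
  obtains p where "inj p" "M = range (pred_edge p)"
proof -
  have "snd ` M = range V2"
    using snd_matching_subset[OF M] card_image[OF inj_on_snd_matching[OF M]] card card_range_V2
    by (metis card_subset_eq finite finite_imageI)
  then have ex: "\<exists>y. (y, V2 v) \<in> M" for v by (force simp: image_iff set_eq_iff)
  have form: "\<exists>s. y = case_sum V1 U s" if "(y, V2 v) \<in> M" for y v
  proof -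
    have "(y, V2 v) \<in> bipartite_edges A B" using M that by (auto simp: matching_def)
    then show ?thesis
      by (auto simp: bipartite_edges_def edges_A_def edges_B_def
          intro: exI[of _ "Inl _"] exI[of _ "Inr _"])
  qed
  have "\<forall>v. \<exists>s. (case_sum V1 U s, V2 v) \<in> M" using ex form by metis
  then obtain p where "\<And>v. (case_sum V1 U (p v), V2 v) \<in> M" by metis
  then have p: "pred_edge p v \<in> M" for v by (simp add: pred_edge_def)
  have "inj p"
  proof (rule injI)
    fix v v' assume eq: "p v = p v'"
    show "v = v'"
    proof (rule ccontr)
      assume "v \<noteq> v'"
      then have "pred_edge p v \<noteq> pred_edge p v'" by (simp add: pred_edge_def)
      then show False
        using M p[of v] p[of v'] eq unfolding matching_def by (fastforce simp: pred_edge_def)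
    qed
  qed
  moreover have "range (pred_edge p) = M"
    using p card card_range_pred_edge[of p]
    by (intro card_subset_eq) (auto intro: card_ge_0_finite)
  ultimately show thesis using that by blast
qed

section \<open>Structural controllability and perfect matchings\<close>

lemma structurally_controllable_perfect_matching:
  fixes A :: "('d::finite, 'd) sparsity" and B :: "('m::finite, 'd) sparsity"
  assumes "structurally_controllable A B"
  obtains N where "matching (bipartite_edges A B) N" "card N = CARD('d)"
proof -
  obtain p where "inj p" "\<And>v w. p v = Inl w \<Longrightarrow> A $ v $ w \<noteq> Zero"
    "\<And>v k. p v = Inr k \<Longrightarrow> B $ v $ k \<noteq> Zero"
    using structurally_controllable_transversal[OF assms] by blast
  then have "matching (bipartite_edges A B) (range (pred_edge p))"
    by (intro matching_range_pred_edge) (auto simp: pred_edge_mem_bipartite_edges split: sum.splits)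
  then show thesis using that card_range_pred_edge by blast
qed

text \<open>Acyclicity rules out closed cycles of predecessors, so every chain begins at an
  input.\<close>

lemma structurally_controllable_matching_pattern:
  fixes A :: "('d::finite, 'd) sparsity" and B :: "('m::finite, 'd) sparsity"
  assumes M: "matching (bipartite_edges A B) M" "card M = CARD('d)"
    and acyc: "acyclic (digraph_of A)"
  shows "structurally_controllable A (matching_pattern B M)"
proof -
  obtain p where p: "inj p" "M = range (pred_edge p)"
    by (rule perfect_matching_eq_range_pred_edge[OF M])
  then have edge: "pred_edge p v \<in> bipartite_edges A B" for v
    using M(1) unfolding matching_def by blast
  have A: "A $ v $ w \<noteq> Zero" if "p v = Inl w" for v w
    using edge[of v] that by (simp add: pred_edge_mem_bipartite_edges)
  have B: "B $ v $ k \<noteq> Zero" if "p v = Inr k" for v k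
    using edge[of v] that by (simp add: pred_edge_mem_bipartite_edges)
  have "acyclic {(w, v). p v = Inl w}"
    by (rule acyclic_subset[OF acyc]) (auto simp: digraph_of_def A)
  note controllable_chains[OF p(1) this]
  moreover have "realization A (\<chi> v w. if p v = Inl w then 1 else 0)"
    using A by (auto simp: realization_def)
  moreover have "realization (matching_pattern B M) (\<chi> v k. if p v = Inr k then 1 else 0)"
    using B by (auto simp: realization_def matching_pattern_def p(2) pred_edge_def edges_B_def image_iff
        split: if_splits)
  ultimately show ?thesis unfolding structurally_controllable_def by blast
qed

section \<open>Costs and optimality\<close>

text \<open>State edges cost nothing, and the input edges of \<open>M\<close> correspond one to one
  to the stars of its pattern.\<close>

lemma sum_edge_cost_eq_weight:
  assumes "M \<subseteq> bipartite_edges A B"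
  shows "sum (edge_cost w) M = weight w (matching_pattern B M)"
proof -
  have "sum (edge_cost w) M = sum (edge_cost w) (M \<inter> edges_B B)"
    using assms finite_subset[OF assms finite_bipartite_edges]
    by (intro sum.mono_neutral_right) (auto simp: bipartite_edges_def edges_A_def)
  also have "M \<inter> edges_B B =
      (\<lambda>(l, k). (U k, V2 l)) ` {(l, k). matching_pattern B M $ l $ k \<noteq> Zero}"
    by (auto simp: matching_pattern_def edges_B_def image_iff split: if_splits)
  also have "sum (edge_cost w) \<dots> = weight w (matching_pattern B M)"
    unfolding weight_def by (subst sum.reindex) (auto simp: inj_on_def intro!: sum.cong)
  finally show ?thesis .
qed

lemma weight_matching_pattern_le:
  assumes "\<And>i j. B $ i $ j \<noteq> Zero \<Longrightarrow> 0 \<le> w i j"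
  shows "weight w (matching_pattern B M) \<le> weight w B"
  unfolding weight_def
  by (rule sum_mono2) (use assms in \<open>auto simp: matching_pattern_def edges_B_def split: if_splits\<close>)

theorem proposition4p13:
  fixes A :: "('d::finite, 'd) sparsity"
    and B Bstar :: "('m::finite, 'd) sparsity"
    and w :: "'d \<Rightarrow> 'm \<Rightarrow> real"
    and r :: 'd
  assumes "structurally_controllable A B"
    and "\<And>i j. B $ i $ j \<noteq> Zero \<Longrightarrow> 0 \<le> w i j"
    and "directed_tree_rooted_at (digraph_of A) r"
    and "matching_algorithm_output A B w Bstar"
  shows "Bstar \<in> feasible A B \<and> (\<forall>B' \<in> feasible A B. weight w Bstar \<le> weight w B')"
proof -
  obtain M where max: "maximum_matching (bipartite_edges A B) M"
    and min: "\<And>N. maximum_matching (bipartite_edges A B) N \<Longrightarrow>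
      sum (edge_cost w) M \<le> sum (edge_cost w) N"
    and Bstar: "Bstar = matching_pattern B M"
    using assms(4) unfolding matching_algorithm_output_def min_cost_maximum_matching_def by blast
  have M: "matching (bipartite_edges A B) M" using max by (simp add: maximum_matching_def)
  \<comment> \<open>A perfect matching exists for \<open>B\<close> itself, so the maximum matching
    \<open>M\<close> is perfect too.\<close>
  obtain N0 where "matching (bipartite_edges A B) N0" "card N0 = CARD('d)"
    using structurally_controllable_perfect_matching[OF assms(1)] by blast
  then have "card M = CARD('d)"
    using max card_matching_le[OF M] unfolding maximum_matching_def by (metis le_antisym)
  then have "structurally_controllable A Bstar"
    unfolding Bstar using M assms(3)
    by (intro structurally_controllable_matching_pattern) (auto simp: directed_tree_rooted_at_def)
  moreover have "zero_pattern B \<subseteq> zero_pattern Bstar"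
    by (auto simp: zero_pattern_def Bstar matching_pattern_def edges_B_def)
  moreover have "weight w Bstar \<le> weight w B'" if "B' \<in> feasible A B" for B'
  proof -
    have sub: "B $ i $ j \<noteq> Zero" if "B' $ i $ j \<noteq> Zero" for i j
      using that \<open>B' \<in> feasible A B\<close> by (auto simp: feasible_def zero_pattern_def)
    obtain N where N: "matching (bipartite_edges A B') N" "card N = CARD('d)"
      using \<open>B' \<in> feasible A B\<close> structurally_controllable_perfect_matching
      by (auto simp: feasible_def)
    \<comment> \<open>A perfect matching for \<open>B'\<close> thereby competes with
      \<open>M\<close> in the graph of \<open>B\<close>.\<close>
    have "bipartite_edges A B' \<subseteq> bipartite_edges A B"
      using sub by (auto simp: bipartite_edges_def edges_B_def)
    then have "matching (bipartite_edges A B) N" using N(1) unfolding matching_def by blast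
    then have "maximum_matching (bipartite_edges A B) N"
      using N(2) card_matching_le unfolding maximum_matching_def by metis
    then have "weight w Bstar \<le> sum (edge_cost w) N"
      using min M sum_edge_cost_eq_weight[of M A B w] by (simp add: Bstar matching_def)
    also have "\<dots> = weight w (matching_pattern B' N)"
      using N(1) sum_edge_cost_eq_weight[of N A B' w] by (simp add: matching_def)
    also have "\<dots> \<le> weight w B'"
      using sub assms(2) by (intro weight_matching_pattern_le) blast
    finally show ?thesis .
  qed
  ultimately show ?thesis by (auto simp: feasible_def)
qed

end
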